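(* Let $G$ be a finite graph. The class $\mathcal{K}$ of all graphs $H$ such that there is no strong homomorphism of $G$ into any induced term subgraph of $H$ is defined by the set $\Xi_G$ of implications (specified in the context); that is, $\mathcal{K}=\operatorname{Mod}\Xi_G$.
   Context: Graphs. A graph $G=(V,E)$ consists of a set $V=V(G)$ of vertices and a set $E=E(G)\subseteq V\times V$ of (directed) edges; loops are allowed. A strong homomorphism $h\colon G\to G'$ is a map $V(G)\to V(G')$ such that for all $u,v\in V(G)$: $(u,v)\in E(G)$ if and only if $(h(u),h(v))\in E(G')$. $G$ is an induced subgraph of $G'$ if $V(G)\subseteq V(G')$ and $E(G)=E(G')\cap(V(G)\times V(G))$. Terms and term graphs. Terms are built from variables and the constant symbol $\infty$ using one binary operation symbol (juxtaposition). A term is trivial if $\infty$ occurs in it. $L(t)$ is the leftmost variable occurring in a nontrivial term $t$, and $\operatorname{var}(t)$ the set of its variables. For a nontrivial term $t$, the graph $G(t)$ has vertex set $\operatorname{var}(t)$ and edge set $E(t)$ defined by $E(x)=\emptyset$ for a variable $x$, and $E(t_1t_2)=E(t_1)\cup E(t_2)\cup\{(L(t_1),L(t_2))\}$. A term graph is a graph isomorphic to $G(t)$ for some nontrivial term $t$; equivalently, a finite graph having a vertex from which every vertex is reachable by a directed walk (of length $\ge 0$). An induced term subgraph of $H$ is an induced subgraph of $H$ that is a term graph. Graph algebras and implications. For a graph $H$ and an element $\infty\notin V(H)$, the graph algebra $\mathbb{A}(H)$ has universe $V(H)\cup\{\infty\}$, the constant $\infty$, and the binary operation $x\cdot y:=x$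 if $(x,y)\in E(H)$ and $x\cdot y:=\infty$ otherwise. An identity is a pair $s\approx t$ of terms. An implication $\alpha\to\beta$ consists of a finite set $\alpha$ of identities and an identity $\beta=(s\approx t)$; the (finitely many) variables may be named arbitrarily. An assignment is a map $h$ from the variables to $V(H)\cup\{\infty\}$, extended to terms by evaluation in $\mathbb{A}(H)$. $H\models\alpha\to\beta$ means: for every assignment $h$, if $h(s_i)=h(t_i)$ for all $s_i\approx t_i\in\alpha$, then $h(s)=h(t)$. $\operatorname{Mod}\Sigma$ is the class of all graphs satisfying every member of the set $\Sigma$ of implications. Encoding of graphs. For a finite graph $F$, use a variable $x_a$ for each $a\in V(F)$, and put $\Gamma_{\mathrm e}(F):=\{x_ax_b\approx x_a\mid (a,b)\in E(F)\}$, $\Gamma_{\mathrm n}(F):=\{x_ax_b\approx\infty\mid a,b\in V(F),\ (a,b)\notin E(F)\}$, $\Sigma(F):=\Gamma_{\mathrm e}(F)\cup\Gamma_{\mathrm n}(F)$. The set $\Xi_G$. Let $G$ be a finite graph. A strongly connected component $C$ of $G$ is a source if there is no edge $(u,v)\in E(G)$ with $u\in V(G)\setminus V(C)$, $v\in V(C)$. Fix a transversal $S$ of the vertex sets of the sources of $G$ (i.e., $S$ consists of exactly one vertex from each source). For each $\varphi\colon S\to\mathbb{N}$ (where $0\in\mathbb{N}$), let $S_\varphi^0:=\{a\in S\mid\varphi(a)=0\}$ and $S_\varphi^+:=\{a\in S\mid\varphi(a)>0\}$, and let $T_\varphi$ be a directed tree consisting of a root $r$ and, for each $a\in S_\varphi^+$,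 a directed path of length $\varphi(a)$ from $r$ to $a$, such that these paths are pairwise disjoint except for the common root $r$ and $V(T_\varphi)\cap V(G)=S_\varphi^+$. Set \[ \alpha_\varphi:=\Sigma(G)\cup\Gamma_{\mathrm e}(T_\varphi)\cup\{x_a\approx x_r\mid a\in S_\varphi^0\},\qquad \beta:=(x_r\approx\infty), \] (implications over the variables $x_a$, $a\in V(G)\cup V(T_\varphi)$), and $\Xi_G:=\{\alpha_\varphi\to\beta\mid\varphi\in\mathbb{N}^S\}$. *)

theory Defs
  imports "Graph_Theory.Digraph_Component" "HOL-Library.FuncSet"
begin

text \<open>
  Graphs are the pair digraphs of \<^theory>\<open>Graph_Theory.Pair_Digraph\<close>: a vertex set together with
  a set of ordered pairs of vertices, loops being allowed. A graph is a value satisfying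
  \<^const>\<open>pair_wf_digraph\<close>, a finite graph one satisfying \<^const>\<open>pair_fin_digraph\<close>; the vertex
  set may be empty.
\<close>

definition strong_hom ::
    "('a \<Rightarrow> 'b) \<Rightarrow> 'a pair_pre_digraph \<Rightarrow> 'b pair_pre_digraph \<Rightarrow> bool" where
  "strong_hom h G G' \<longleftrightarrow>
     (\<forall>u\<in>pverts G. h u \<in> pverts G') \<and>
     (\<forall>u\<in>pverts G. \<forall>v\<in>pverts G. (u, v) \<in> parcs G \<longleftrightarrow> (h u, h v) \<in> parcs G')"

text \<open>
  The isomorphism notion of the library compares the head and tail functions also outside the
  arc set, so it is not used here.
\<close>

definition graph_iso :: "'a pair_pre_digraph \<Rightarrow> 'b pair_pre_digraph \<Rightarrow> bool" where
  "graph_iso G G' \<longleftrightarrow> (\<exists>f. bij_betw f (pverts G) (pverts G') \<and> strong_hom f G G')"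


datatype (vars: 'v) trm = Var 'v | Infty | App "'v trm" "'v trm"

primrec nontrivial :: "'v trm \<Rightarrow> bool" where
  "nontrivial (Var x) = True"
| "nontrivial Infty = False"
| "nontrivial (App s t) = (nontrivial s \<and> nontrivial t)"

text \<open>The values of the next two functions are relevant for nontrivial terms only.\<close>

primrec leftmost :: "'v trm \<Rightarrow> 'v" where
  "leftmost (Var x) = x"
| "leftmost Infty = undefined"
| "leftmost (App s t) = leftmost s"

primrec trm_edges :: "'v trm \<Rightarrow> ('v \<times> 'v) set" where
  "trm_edges (Var x) = {}"
| "trm_edges Infty = {}"
| "trm_edges (App s t) = trm_edges s \<union> trm_edges t \<union> {(leftmost s, leftmost t)}"

definition graph_of_trm :: "'v trm \<Rightarrow> 'v pair_pre_digraph" where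
  "graph_of_trm t = \<lparr>pverts = vars t, parcs = trm_edges t\<rparr>"

text \<open>Terms have finitely many variables, so naming these by natural numbers loses no generality.\<close>

definition is_term_graph :: "'a pair_pre_digraph \<Rightarrow> bool" where
  "is_term_graph F \<longleftrightarrow>
     pair_wf_digraph F \<and> (\<exists>t :: nat trm. nontrivial t \<and> graph_iso (graph_of_trm t) F)"

definition induced_term_subgraph ::
    "'a pair_pre_digraph \<Rightarrow> 'a pair_pre_digraph \<Rightarrow> bool" where
  "induced_term_subgraph F H \<longleftrightarrow>
     induced_subgraph (with_proj F) (with_proj H) \<and> is_term_graph F"


text \<open>In the graph algebra, \<^const>\<open>None\<close> plays the role of the element \<open>\<infinity>\<close>.\<close>

definition ga_universe :: "'b pair_pre_digraph \<Rightarrow> 'b option set" where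
  "ga_universe H = insert None (Some ` pverts H)"

fun ga_mult :: "'b pair_pre_digraph \<Rightarrow> 'b option \<Rightarrow> 'b option \<Rightarrow> 'b option" where
  "ga_mult H (Some x) (Some y) = (if (x, y) \<in> parcs H then Some x else None)"
| "ga_mult H _ _ = None"

primrec eval_trm :: "'b pair_pre_digraph \<Rightarrow> ('v \<Rightarrow> 'b option) \<Rightarrow> 'v trm \<Rightarrow> 'b option" where
  "eval_trm H h (Var x) = h x"
| "eval_trm H h Infty = None"
| "eval_trm H h (App s t) = ga_mult H (eval_trm H h s) (eval_trm H h t)"

type_synonym 'v identity = "'v trm \<times> 'v trm"

text \<open>
  Finiteness of the set of premises is not enforced by the type; for the implications considered
  below it is established in the lemma \<open>finite_premises\<close>.
\<close>

type_synonym 'v implication = "'v identity set \<times> 'v identity"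

definition sat_identity :: "'b pair_pre_digraph \<Rightarrow> ('v \<Rightarrow> 'b option) \<Rightarrow> 'v identity \<Rightarrow> bool" where
  "sat_identity H h e \<longleftrightarrow> eval_trm H h (fst e) = eval_trm H h (snd e)"

definition models :: "'b pair_pre_digraph \<Rightarrow> 'v implication \<Rightarrow> bool" where
  "models H i \<longleftrightarrow>
     (\<forall>h. (\<forall>x. h x \<in> ga_universe H) \<longrightarrow> (\<forall>e\<in>fst i. sat_identity H h e) \<longrightarrow>
        sat_identity H h (snd i))"

definition Mod :: "'v implication set \<Rightarrow> 'b pair_pre_digraph set" where
  "Mod \<Sigma> = {H. pair_wf_digraph H \<and> (\<forall>i\<in>\<Sigma>. models H i)}"


text \<open>The argument \<open>x\<close> assigns to each vertex \<open>a\<close> the variable \<open>x\<^sub>a\<close>.\<close>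

definition Gamma_e :: "('a \<Rightarrow> 'v) \<Rightarrow> 'a pair_pre_digraph \<Rightarrow> 'v identity set" where
  "Gamma_e x F = {(App (Var (x a)) (Var (x b)), Var (x a)) | a b. (a, b) \<in> parcs F}"

definition Gamma_n :: "('a \<Rightarrow> 'v) \<Rightarrow> 'a pair_pre_digraph \<Rightarrow> 'v identity set" where
  "Gamma_n x F = {(App (Var (x a)) (Var (x b)), Infty) | a b.
     a \<in> pverts F \<and> b \<in> pverts F \<and> (a, b) \<notin> parcs F}"

definition Sigma_of :: "('a \<Rightarrow> 'v) \<Rightarrow> 'a pair_pre_digraph \<Rightarrow> 'v identity set" where
  "Sigma_of x F = Gamma_e x F \<union> Gamma_n x F"


text \<open>Sources are represented by the vertex sets of the components.\<close>

definition sources :: "'a pair_pre_digraph \<Rightarrow> 'a set set" where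
  "sources G = {C \<in> pre_digraph.sccs_verts (with_proj G).
     \<not> (\<exists>u v. (u, v) \<in> parcs G \<and> u \<in> pverts G - C \<and> v \<in> C)}"

definition source_transversal :: "'a pair_pre_digraph \<Rightarrow> 'a set \<Rightarrow> bool" where
  "source_transversal G S \<longleftrightarrow> S \<subseteq> \<Union> (sources G) \<and> (\<forall>C\<in>sources G. \<exists>!a. a \<in> S \<and> a \<in> C)"

text \<open>
  Vertices of \<open>G\<close> and of the trees \<open>T\<^sub>\<phi>\<close>, which also serve as names of variables: \<open>Orig a\<close> is the
  vertex \<open>a\<close> of \<open>G\<close>, \<open>Root\<close> is the root \<open>r\<close>, and \<open>Inner a i\<close> is the \<open>i\<close>-th vertex strictly between
  \<open>r\<close> and \<open>a\<close> on the path from \<open>r\<close> to \<open>a\<close>.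
\<close>

datatype 'a node = Orig 'a | Root | Inner 'a nat

definition S_zero :: "'a set \<Rightarrow> ('a \<Rightarrow> nat) \<Rightarrow> 'a set" where
  "S_zero S \<phi> = {a \<in> S. \<phi> a = 0}"

definition S_pos :: "'a set \<Rightarrow> ('a \<Rightarrow> nat) \<Rightarrow> 'a set" where
  "S_pos S \<phi> = {a \<in> S. \<phi> a > 0}"

text \<open>
  For \<open>n > 0\<close>, the path of length \<open>n\<close> from the root to \<open>a\<close> is
  \<open>path_node a n 0, \<dots>, path_node a n n\<close>.
\<close>

definition path_node :: "'a \<Rightarrow> nat \<Rightarrow> nat \<Rightarrow> 'a node" where
  "path_node a n i = (if i = 0 then Root else if i = n then Orig a else Inner a i)"

definition path_tree :: "'a set \<Rightarrow> ('a \<Rightarrow> nat) \<Rightarrow> 'a node pair_pre_digraph" where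
  "path_tree S \<phi> =
     \<lparr>pverts = insert Root {path_node a (\<phi> a) i | a i. a \<in> S_pos S \<phi> \<and> i \<le> \<phi> a},
      parcs = {(path_node a (\<phi> a) i, path_node a (\<phi> a) (Suc i)) | a i. a \<in> S_pos S \<phi> \<and> i < \<phi> a}\<rparr>"

definition alpha :: "'a pair_pre_digraph \<Rightarrow> 'a set \<Rightarrow> ('a \<Rightarrow> nat) \<Rightarrow> 'a node identity set" where
  "alpha G S \<phi> = Sigma_of Orig G \<union> Gamma_e id (path_tree S \<phi>) \<union>
     {(Var (Orig a), Var Root) | a. a \<in> S_zero S \<phi>}"

definition beta :: "'a node identity" where
  "beta = (Var Root, Infty)"

definition Xi :: "'a pair_pre_digraph \<Rightarrow> 'a set \<Rightarrow> 'a node implication set" where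
  "Xi G S = {(alpha G S \<phi>, beta) | \<phi>. \<phi> \<in> S \<rightarrow>\<^sub>E (UNIV :: nat set)}"


lemma path_tree_inter:
  assumes "S \<subseteq> pverts G"
  shows "pverts (path_tree S \<phi>) \<inter> Orig ` pverts G = Orig ` S_pos S \<phi>"
proof
  show "pverts (path_tree S \<phi>) \<inter> Orig ` pverts G \<subseteq> Orig ` S_pos S \<phi>"
    by (auto simp: path_tree_def path_node_def split: if_splits)
  show "Orig ` S_pos S \<phi> \<subseteq> pverts (path_tree S \<phi>) \<inter> Orig ` pverts G"
  proof
    fix x assume "x \<in> Orig ` S_pos S \<phi>"
    then obtain a where a: "a \<in> S_pos S \<phi>" "x = Orig a" by blast
    then have "x = path_node a (\<phi> a) (\<phi> a)" by (simp add: path_node_def S_pos_def)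
    with a(1) have "x \<in> pverts (path_tree S \<phi>)" by (auto simp: path_tree_def)
    with a assms show "x \<in> pverts (path_tree S \<phi>) \<inter> Orig ` pverts G"
      by (auto simp: S_pos_def)
  qed
qed

lemma source_subset:
  assumes "C \<in> sources G"
  shows "C \<subseteq> pverts G"
proof
  fix u assume "u \<in> C"
  with assms have "u \<rightarrow>\<^sup>*\<^bsub>with_proj G\<^esub> u"
    by (auto simp: sources_def pre_digraph.sccs_verts_def)
  then show "u \<in> pverts G"
    by (rule reachable_in_vertsE) simp
qed

lemma finite_premises:
  assumes G: "pair_fin_digraph G" and S: "source_transversal G S" and i: "i \<in> Xi G S"
  shows "finite (fst i)"
proof -
  have V: "finite (pverts G)" and E: "finite (parcs G)"
    using G by (auto simp: pair_fin_digraph_def pair_fin_digraph_axioms_def)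
  have "\<Union> (sources G) \<subseteq> pverts G"
    by (rule Union_least) (rule source_subset)
  then have "S \<subseteq> pverts G"
    using S unfolding source_transversal_def by (meson order_trans)
  then have fS: "finite S" using V finite_subset by blast
  obtain \<phi> where \<phi>: "fst i = alpha G S \<phi>" using i by (auto simp: Xi_def)
  have 1: "finite (Gamma_e x F)" if "finite (parcs F)"
    for x :: "'c \<Rightarrow> 'd" and F
  proof -
    have "Gamma_e x F = (\<lambda>(a, b). (App (Var (x a)) (Var (x b)), Var (x a))) ` parcs F"
      by (auto simp: Gamma_e_def)
    then show ?thesis using that by simp
  qed
  have "Gamma_n Orig G \<subseteq>
      (\<lambda>(a, b). (App (Var (Orig a)) (Var (Orig b)), Infty)) ` (pverts G \<times> pverts G)"
    by (auto simp: Gamma_n_def)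
  then have 2: "finite (Gamma_n Orig G)"
    by (rule finite_subset) (simp add: V)
  have "parcs (path_tree S \<phi>) =
      (\<Union>a\<in>S_pos S \<phi>. (\<lambda>i. (path_node a (\<phi> a) i, path_node a (\<phi> a) (Suc i))) ` {..<\<phi> a})"
    by (auto simp: path_tree_def)
  then have 3: "finite (parcs (path_tree S \<phi>))"
    using fS by (simp add: S_pos_def)
  show ?thesis
    using E fS 1[of G Orig] 1[OF 3, of id] 2
    by (auto simp: \<phi> alpha_def Sigma_of_def S_zero_def)
qed

end

theory Submission
  imports Defs
begin

text \<open>
  An assignment that satisfies the premises and gives \<open>x\<^sub>r\<close> a value other than \<open>\<infinity>\<close> gives every
  variable of the implication such a value: along an edge \<open>(a, b)\<close> the premise \<open>x\<^sub>a x\<^sub>b \<approx> x\<^sub>a\<close> propagates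
  definedness from \<open>a\<close> to \<open>b\<close>, and every vertex of \<open>G\<close> is reachable from \<open>S\<close>. The values then
  induce a term subgraph rooted at the value of \<open>x\<^sub>r\<close>, and the assignment restricts to a strong
  homomorphism of \<open>G\<close> into it. Conversely, given a strong homomorphism \<open>g\<close> into a term subgraph
  with root \<open>r\<close>, walks from \<open>r\<close> to the vertices \<open>g a\<close> for \<open>a \<in> S\<close> yield a \<open>\<phi>\<close> and an assignment
  refuting the corresponding implication.
\<close>

section \<open>Term graphs are the finite rooted graphs\<close>

lemma leftmost_in_vars: "nontrivial t \<Longrightarrow> leftmost t \<in> vars t"
  by (induction t) auto

lemma trm_edges_subset_vars: "nontrivial t \<Longrightarrow> trm_edges t \<subseteq> vars t \<times> vars t"
  by (induction t) (auto dest: leftmost_in_vars)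

lemma finite_vars: "finite (vars t)"
  by (induction t) auto

text \<open>The leftmost variable is a root of the graph: in \<open>App s t\<close> the one new edge
  leads from the root of \<open>s\<close> to the root of \<open>t\<close>, so everything in
  \<open>t\<close> is reached through it.\<close>

lemma leftmost_reaches_vars:
  assumes "nontrivial t" "v \<in> vars t"
  shows "(leftmost t, v) \<in> (trm_edges t)\<^sup>*"
  using assms
proof (induction t)
  case (App s t)
  let ?E = "trm_edges (App s t)"
  have mono: "(trm_edges s)\<^sup>* \<subseteq> ?E\<^sup>*" "(trm_edges t)\<^sup>* \<subseteq> ?E\<^sup>*"
    by (auto intro!: rtrancl_mono)
  show ?case
  proof (cases "v \<in> vars s")
    case True
    then show ?thesis using App mono by auto
  next
    case False
    with App have "(leftmost t, v) \<in> ?E\<^sup>*" using mono by auto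
    moreover have "(leftmost s, leftmost t) \<in> ?E" by simp
    ultimately show ?thesis by (metis converse_rtrancl_into_rtrancl leftmost.simps(3))
  qed
qed auto

text \<open>Replacing an occurrence of \<open>u\<close> by the product \<open>u v\<close> adds just the edge \<open>(u, v)\<close>.\<close>

lemma add_edge_trm:
  assumes "nontrivial t" "u \<in> vars t"
  shows "\<exists>t'. nontrivial t' \<and> leftmost t' = leftmost t \<and> vars t' = insert v (vars t) \<and>
    trm_edges t' = insert (u, v) (trm_edges t)"
  using assms
proof (induction t)
  case (Var x)
  then show ?case by (intro exI[of _ "App (Var u) (Var v)"]) auto
next
  case (App s t)
  show ?case
  proof (cases "u \<in> vars s")
    case True
    with App obtain s' where "nontrivial s'" "leftmost s' = leftmost s"
      "vars s' = insert v (vars s)" "trm_edges s' = insert (u, v) (trm_edges s)" by auto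
    with App show ?thesis by (intro exI[of _ "App s' t"]) auto
  next
    case False
    with App obtain t' where "nontrivial t'" "leftmost t' = leftmost t"
      "vars t' = insert v (vars t)" "trm_edges t' = insert (u, v) (trm_edges t)" by auto
    with App show ?thesis by (intro exI[of _ "App s t'"]) auto
  qed
qed simp

text \<open>Among the terms with leftmost variable \<open>r\<close> whose graph lies in
  \<open>F\<close>, take one with as many edges as possible. An edge of \<open>F\<close> missing at
  one of its variables could be added by \<open>add_edge_trm\<close>, so none is missing, and
  reachability from \<open>r\<close> then brings in every vertex.\<close>

lemma rooted_graph_is_graph_of_trm:
  assumes F: "pair_fin_digraph F" and r: "r \<in> pverts F"
    and reach: "\<And>v. v \<in> pverts F \<Longrightarrow> (r, v) \<in> (parcs F)\<^sup>*"
  obtains t where "nontrivial t" "graph_of_trm t = F"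
proof -
  interpret pair_fin_digraph F by fact
  define P where "P t \<longleftrightarrow> nontrivial t \<and> leftmost t = r \<and> vars t \<subseteq> pverts F \<and>
    trm_edges t \<subseteq> parcs F" for t
  have "P (Var r)" using r by (simp add: P_def)
  moreover have "\<forall>t. P t \<longrightarrow> card (trm_edges t) < Suc (card (parcs F))"
    by (auto simp: P_def less_Suc_eq_le intro!: card_mono pair_finite_arcs)
  ultimately obtain t where t: "P t"
    and max: "\<And>t'. P t' \<Longrightarrow> card (trm_edges t') \<le> card (trm_edges t)"
    using ex_has_greatest_nat[of P "Var r" "\<lambda>t. card (trm_edges t)"] by blast
  have nt: "nontrivial t" and lt: "leftmost t = r" and tv: "vars t \<subseteq> pverts F"
    and te: "trm_edges t \<subseteq> parcs F" using t by (auto simp: P_def)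
  have fin: "finite (trm_edges t)" using te pair_finite_arcs finite_subset by blast
  have closed: "(u, v) \<in> trm_edges t" if uv: "u \<in> vars t" "(u, v) \<in> parcs F" for u v
  proof (rule ccontr)
    assume new: "(u, v) \<notin> trm_edges t"
    obtain t' where t': "nontrivial t'" "leftmost t' = leftmost t" "vars t' = insert v (vars t)"
      "trm_edges t' = insert (u, v) (trm_edges t)"
      using add_edge_trm[OF nt uv(1)] by blast
    have "P t'" using t' lt tv te uv by (auto simp: P_def dest: in_arcsD2)
    then show False using max[of t'] t' new fin by simp
  qed
  have "v \<in> vars t" if "(r, v) \<in> (parcs F)\<^sup>*" for v
    using that
  proof (induction rule: rtrancl_induct)
    case base
    then show ?case using leftmost_in_vars[OF nt] lt by simp
  next
    case (step u v)
    then show ?case using closed trm_edges_subset_vars[OF nt] by blast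
  qed
  then have vars: "vars t = pverts F" using reach tv by blast
  have "trm_edges t = parcs F"
    using te closed in_arcsD1 unfolding vars by auto
  with vars have "graph_of_trm t = F" by (simp add: graph_of_trm_def)
  with nt show ?thesis by (rule that)
qed

lemma nontrivial_map_trm: "nontrivial (map_trm f t) = nontrivial t"
  by (induction t) auto

lemma leftmost_map_trm: "nontrivial t \<Longrightarrow> leftmost (map_trm f t) = f (leftmost t)"
  by (induction t) auto

lemma trm_edges_map_trm:
  "nontrivial t \<Longrightarrow> trm_edges (map_trm f t) = map_prod f f ` trm_edges t"
  by (induction t) (auto simp: leftmost_map_trm image_Un)

text \<open>Walks from the leftmost variable are carried over by the isomorphism. Conversely, a
  finite rooted graph is the graph of a term over its own vertices, and only the variables have to
  be renamed to natural numbers.\<close>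

lemma is_term_graph_iff_rooted:
  "is_term_graph F \<longleftrightarrow>
     pair_fin_digraph F \<and> (\<exists>r\<in>pverts F. \<forall>v\<in>pverts F. (r, v) \<in> (parcs F)\<^sup>*)"
proof (intro iffI conjI; (elim conjE bexE)?)
  assume "is_term_graph F"
  then obtain t :: "nat trm" and f where wf: "pair_wf_digraph F" and t: "nontrivial t"
    and bij: "bij_betw f (vars t) (pverts F)"
    and hom: "\<And>u v. u \<in> vars t \<Longrightarrow> v \<in> vars t \<Longrightarrow> (u, v) \<in> trm_edges t \<longleftrightarrow> (f u, f v) \<in> parcs F"
    by (auto simp: is_term_graph_def graph_iso_def graph_of_trm_def strong_hom_def)
  interpret pair_wf_digraph F by fact
  have fin: "finite (pverts F)" using bij bij_betw_finite finite_vars by blast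
  moreover have "parcs F \<subseteq> pverts F \<times> pverts F" by (auto dest: in_arcsD1 in_arcsD2)
  ultimately show "pair_fin_digraph F"
    by unfold_locales (auto intro: finite_subset)
  show "\<exists>r\<in>pverts F. \<forall>v\<in>pverts F. (r, v) \<in> (parcs F)\<^sup>*"
  proof (intro bexI ballI)
    show "f (leftmost t) \<in> pverts F"
      using bij leftmost_in_vars[OF t] by (auto simp: bij_betw_def)
    fix v assume "v \<in> pverts F"
    then obtain x where x: "x \<in> vars t" "v = f x" using bij by (auto simp: bij_betw_def)
    have "(leftmost t, x) \<in> (trm_edges t)\<^sup>*" using t x(1) by (rule leftmost_reaches_vars)
    then have "(f (leftmost t), f x) \<in> (parcs F)\<^sup>*"
    proof (induction rule: rtrancl_induct)
      case (step y z)
      then have "(f y, f z) \<in> parcs F" using hom trm_edges_subset_vars[OF t] by blast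
      with step show ?case by simp
    qed simp
    then show "(f (leftmost t), v) \<in> (parcs F)\<^sup>*" using x by simp
  qed
next
  fix r assume F: "pair_fin_digraph F" and "r \<in> pverts F"
    and "\<forall>v\<in>pverts F. (r, v) \<in> (parcs F)\<^sup>*"
  then obtain t where t: "nontrivial t" and tF: "graph_of_trm t = F"
    by (metis rooted_graph_is_graph_of_trm)
  interpret pair_fin_digraph F by fact
  have V: "pverts F = vars t" and E: "parcs F = trm_edges t"
    using tF by (auto simp: graph_of_trm_def)
  \<comment> \<open>The numbering \<open>f\<close> renames the variables; the isomorphism runs from
    the renamed graph back to \<open>F\<close>, hence the inverse \<open>g\<close>.\<close>
  obtain f :: "_ \<Rightarrow> nat" where inj: "inj_on f (vars t)"
    using finite_imp_inj_to_nat_seg[OF finite_vars, of t] by blast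
  define g where "g = inv_into (vars t) f"
  have gf: "g (f x) = x" if "x \<in> vars t" for x using inj that by (simp add: g_def)
  have "bij_betw g (f ` vars t) (vars t)"
    unfolding g_def using inj by (simp add: bij_betw_inv_into inj_on_imp_bij_betw)
  moreover have "strong_hom g (graph_of_trm (map_trm f t)) F"
  proof -
    have "(f x, f y) \<in> map_prod f f ` trm_edges t \<longleftrightarrow> (x, y) \<in> trm_edges t"
      if "x \<in> vars t" "y \<in> vars t" for x y
      using that trm_edges_subset_vars[OF t] inj by (auto dest: inj_onD)
    then show ?thesis
      by (simp add: strong_hom_def graph_of_trm_def trm.set_map V E trm_edges_map_trm[OF t] gf)
  qed
  ultimately have "graph_iso (graph_of_trm (map_trm f t)) F"
    unfolding graph_iso_def by (auto simp: graph_of_trm_def trm.set_map V)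
  with t show "is_term_graph F"
    unfolding is_term_graph_def using nontrivial_map_trm pair_wf_digraph_axioms by blast
qed

section \<open>Sources\<close>

text \<open>Among the vertices from which \<open>v\<close> is reachable, choose \<open>u\<close>
  with the fewest ancestors. Its component is a source: an edge entering it from outside would start
  at an ancestor of \<open>u\<close> whose own ancestors do not include \<open>u\<close>,
  contradicting minimality.\<close>

lemma (in pair_fin_digraph) reachable_from_source:
  assumes "v \<in> pverts G"
  obtains C where "C \<in> sources G" "\<And>u. u \<in> C \<Longrightarrow> (u, v) \<in> (parcs G)\<^sup>*"
proof -
  define A where "A u = {w. w \<rightarrow>\<^sup>*\<^bsub>with_proj G\<^esub> u}" for u
  have A_sub: "A u \<subseteq> pverts G" for u
    by (auto simp: A_def dest: reachable_in_verts)
  have fin: "finite (A u)" for u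
    using A_sub pair_finite_verts by (rule finite_subset)
  have "v \<rightarrow>\<^sup>*\<^bsub>with_proj G\<^esub> v" using assms by simp
  then obtain u where uv: "u \<rightarrow>\<^sup>*\<^bsub>with_proj G\<^esub> v"
    and min: "\<And>w. w \<rightarrow>\<^sup>*\<^bsub>with_proj G\<^esub> v \<Longrightarrow> card (A u) \<le> card (A w)"
    using ex_has_least_nat[of "\<lambda>w. w \<rightarrow>\<^sup>*\<^bsub>with_proj G\<^esub> v" v "\<lambda>w. card (A w)"] by blast
  define C where "C = scc_of u"
  have C: "w \<in> C \<longleftrightarrow> u \<rightarrow>\<^sup>*\<^bsub>with_proj G\<^esub> w \<and> w \<rightarrow>\<^sup>*\<^bsub>with_proj G\<^esub> u" for w
    by (simp add: C_def scc_of_def)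
  have "u \<in> pverts G" using uv by (auto dest: reachable_in_verts)
  then have "C \<in> sccs_verts" unfolding C_def by (simp add: scc_of_in_sccs_verts)
  moreover have False if pq: "(p, q) \<in> parcs G" "p \<notin> C" "q \<in> C" for p q
  proof -
    have "p \<rightarrow>\<^sup>*\<^bsub>with_proj G\<^esub> q" using pq(1) by (simp add: reachable_adjI)
    then have pu: "p \<rightarrow>\<^sup>*\<^bsub>with_proj G\<^esub> u" using pq(3) C reachable_trans by blast
    then have "A p \<subseteq> A u" by (auto simp: A_def intro: reachable_trans)
    moreover have "u \<in> A u" using \<open>u \<in> pverts G\<close> by (simp add: A_def)
    moreover have "u \<notin> A p" using pq(2) pu by (simp add: A_def C)
    ultimately have "card (A p) < card (A u)" by (intro psubset_card_mono fin) auto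
    moreover have "card (A u) \<le> card (A p)" using min pu uv reachable_trans by blast
    ultimately show False by simp
  qed
  ultimately have "C \<in> sources G" unfolding sources_def by blast
  moreover have "(w, v) \<in> (parcs G)\<^sup>*" if "w \<in> C" for w
  proof -
    have "w \<rightarrow>\<^sup>*\<^bsub>with_proj G\<^esub> v" using that C uv reachable_trans by blast
    then show ?thesis by (simp add: reachable_conv)
  qed
  ultimately show ?thesis by (rule that)
qed

lemma source_transversal_subset:
  assumes "source_transversal G S"
  shows "S \<subseteq> pverts G"
  using assms source_subset unfolding source_transversal_def by blast

lemma reachable_from_source_transversal:
  assumes "pair_fin_digraph G" "source_transversal G S" "v \<in> pverts G"
  obtains a where "a \<in> S" "(a, v) \<in> (parcs G)\<^sup>*"
proof -
  obtain C where "C \<in> sources G" "\<And>u. u \<in> C \<Longrightarrow> (u, v) \<in> (parcs G)\<^sup>*"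
    using pair_fin_digraph.reachable_from_source[OF assms(1,3)] by blast
  with assms(2) that show ?thesis unfolding source_transversal_def by blast
qed

section \<open>The implications\<close>

text \<open>A product is defined only if both factors are. Hence the identity is vacuous when
  \<open>h x\<close> is \<open>None\<close> and otherwise forces \<open>h y\<close> to be defined,
  which is how definedness travels along edges.\<close>

lemma sat_edge_identity:
  "sat_identity H h (App (Var x) (Var y), Var x) \<longleftrightarrow>
     (\<forall>p. h x = Some p \<longrightarrow> (\<exists>q. h y = Some q \<and> (p, q) \<in> parcs H))"
  by (cases "h x"; cases "h y") (auto simp: sat_identity_def)

lemma sat_nonedge_identity:
  "sat_identity H h (App (Var x) (Var y), Infty) \<longleftrightarrow>
     (\<forall>p q. h x = Some p \<longrightarrow> h y = Some q \<longrightarrow> (p, q) \<notin> parcs H)"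
  by (cases "h x"; cases "h y") (auto simp: sat_identity_def)

lemma sat_Gamma_e_iff:
  "(\<forall>e\<in>Gamma_e x F. sat_identity H h e) \<longleftrightarrow>
     (\<forall>(a, b)\<in>parcs F. \<forall>p. h (x a) = Some p \<longrightarrow>
        (\<exists>q. h (x b) = Some q \<and> (p, q) \<in> parcs H))"
proof -
  have "Gamma_e x F = (\<lambda>(a, b). (App (Var (x a)) (Var (x b)), Var (x a))) ` parcs F"
    by (auto simp: Gamma_e_def)
  then show ?thesis by (simp add: case_prod_beta sat_edge_identity)
qed

lemma sat_alpha_iff:
  "(\<forall>e\<in>alpha G S \<phi>. sat_identity H h e) \<longleftrightarrow>
     (\<forall>a b p. (a, b) \<in> parcs G \<longrightarrow> h (Orig a) = Some p \<longrightarrow>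
        (\<exists>q. h (Orig b) = Some q \<and> (p, q) \<in> parcs H)) \<and>
     (\<forall>a\<in>pverts G. \<forall>b\<in>pverts G. \<forall>p q. (a, b) \<notin> parcs G \<longrightarrow> h (Orig a) = Some p \<longrightarrow>
        h (Orig b) = Some q \<longrightarrow> (p, q) \<notin> parcs H) \<and>
     (\<forall>a\<in>S. \<forall>i<\<phi> a. \<forall>p. h (path_node a (\<phi> a) i) = Some p \<longrightarrow>
        (\<exists>q. h (path_node a (\<phi> a) (Suc i)) = Some q \<and> (p, q) \<in> parcs H)) \<and>
     (\<forall>a\<in>S. \<phi> a = 0 \<longrightarrow> h (Orig a) = h Root)"
proof -
  have edges: "(\<forall>e\<in>Gamma_e Orig G. sat_identity H h e) \<longleftrightarrow>
      (\<forall>a b p. (a, b) \<in> parcs G \<longrightarrow> h (Orig a) = Some p \<longrightarrow>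
        (\<exists>q. h (Orig b) = Some q \<and> (p, q) \<in> parcs H))"
    unfolding sat_Gamma_e_iff by (simp add: Ball_def)
  have nonedges: "(\<forall>e\<in>Gamma_n Orig G. sat_identity H h e) \<longleftrightarrow>
      (\<forall>a\<in>pverts G. \<forall>b\<in>pverts G. \<forall>p q. (a, b) \<notin> parcs G \<longrightarrow> h (Orig a) = Some p \<longrightarrow>
        h (Orig b) = Some q \<longrightarrow> (p, q) \<notin> parcs H)"
    unfolding Gamma_n_def by (fastforce simp: sat_nonedge_identity)
  have tree: "(\<forall>e\<in>Gamma_e id (path_tree S \<phi>). sat_identity H h e) \<longleftrightarrow>
      (\<forall>a\<in>S. \<forall>i<\<phi> a. \<forall>p. h (path_node a (\<phi> a) i) = Some p \<longrightarrow>
        (\<exists>q. h (path_node a (\<phi> a) (Suc i)) = Some q \<and> (p, q) \<in> parcs H))"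
  proof -
    \<comment> \<open>The union may range over all of \<open>S\<close>, since a path of length 0
      contributes no edge.\<close>
    have "parcs (path_tree S \<phi>) =
        (\<Union>a\<in>S. (\<lambda>i. (path_node a (\<phi> a) i, path_node a (\<phi> a) (Suc i))) ` {..<\<phi> a})"
      by (auto simp: path_tree_def S_pos_def) (metis less_nat_zero_code gr0I)
    then show ?thesis unfolding sat_Gamma_e_iff by auto
  qed
  have zero: "(\<forall>e\<in>{(Var (Orig a), Var Root) | a. a \<in> S_zero S \<phi>}. sat_identity H h e) \<longleftrightarrow>
      (\<forall>a\<in>S. \<phi> a = 0 \<longrightarrow> h (Orig a) = h Root)"
    by (fastforce simp: S_zero_def sat_identity_def)
  show ?thesis
    by (simp only: alpha_def Sigma_of_def ball_Un edges nonedges tree zero conj_assoc)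
qed

lemma term_subgraph_of_sat_alpha:
  fixes G :: "'a pair_pre_digraph" and H :: "'b pair_pre_digraph"
  assumes G: "pair_fin_digraph G" and S: "source_transversal G S" and H: "pair_wf_digraph H"
    and universe: "\<And>x. h x \<in> ga_universe H"
    and sat: "\<forall>e\<in>alpha G S \<phi>. sat_identity H h e" and root: "h Root = Some r"
  shows "\<exists>F g. induced_term_subgraph F H \<and> strong_hom g G F"
proof -
  interpret G: pair_fin_digraph G by fact
  interpret H: pair_wf_digraph H by fact
  have SG: "S \<subseteq> pverts G" using S by (rule source_transversal_subset)
  have edge: "\<exists>q. h (Orig b) = Some q \<and> (p, q) \<in> parcs H"
    if "(a, b) \<in> parcs G" "h (Orig a) = Some p" for a b p
    using sat that unfolding sat_alpha_iff by metis
  have nonedge: "(p, q) \<notin> parcs H"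
    if "(a, b) \<notin> parcs G" "a \<in> pverts G" "b \<in> pverts G"
      "h (Orig a) = Some p" "h (Orig b) = Some q" for a b p q
    using sat that unfolding sat_alpha_iff by metis
  have tree_edge: "\<exists>q. h (path_node a (\<phi> a) (Suc i)) = Some q \<and> (p, q) \<in> parcs H"
    if "a \<in> S" "i < \<phi> a" "h (path_node a (\<phi> a) i) = Some p" for a i p
    using sat that unfolding sat_alpha_iff by metis
  have zero: "h (Orig a) = h Root" if "a \<in> S" "\<phi> a = 0" for a
    using sat that unfolding sat_alpha_iff by metis
  \<comment> \<open>\<open>X\<close> collects the variables of the implication. The inner tree
    vertices belong to it because their values supply the walks from \<open>r\<close>; a path of
    length 0 contributes just \<open>Root\<close>.\<close>
  define X where "X = insert Root (Orig ` pverts G \<union>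
    (\<Union>a\<in>S. (\<lambda>i. path_node a (\<phi> a) i) ` {..\<phi> a}))"
  define W where "W = {p. \<exists>x\<in>X. h x = Some p}"
  define F where "F = \<lparr>pverts = W, parcs = parcs H \<inter> W \<times> W\<rparr>"
  have "finite S" using SG G.pair_finite_verts by (rule finite_subset)
  then have "finite X" using G.pair_finite_verts by (simp add: X_def)
  moreover have "W \<subseteq> (\<lambda>x. the (h x)) ` X" by (force simp: W_def)
  ultimately have finW: "finite W" using finite_surj by blast
  have WH: "W \<subseteq> pverts H"
  proof
    fix p assume "p \<in> W"
    then obtain x where "h x = Some p" by (auto simp: W_def)
    then show "p \<in> pverts H" using universe[of x] by (auto simp: ga_universe_def)
  qed
  have finF: "pair_fin_digraph F"
    using finW by unfold_locales (auto simp: F_def)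
  \<comment> \<open>Carrying reachability inside \<open>F\<close> along with definedness lets one
    induction give both that \<open>h\<close> is defined on \<open>X\<close> and that
    \<open>F\<close> is rooted at \<open>r\<close>.\<close>
  define D where "D x \<longleftrightarrow> (\<exists>p. h x = Some p \<and> (r, p) \<in> (parcs F)\<^sup>*)" for x
  have D_step: "D y" if xy: "D x" "x \<in> X" "y \<in> X"
    "\<And>p. h x = Some p \<Longrightarrow> \<exists>q. h y = Some q \<and> (p, q) \<in> parcs H" for x y
  proof -
    obtain p where p: "h x = Some p" "(r, p) \<in> (parcs F)\<^sup>*" using xy(1) by (auto simp: D_def)
    obtain q where q: "h y = Some q" "(p, q) \<in> parcs H" using xy(4) p(1) by blast
    have "(p, q) \<in> parcs F" using p(1) q xy(2,3) by (auto simp: F_def W_def)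
    with p(2) q(1) show ?thesis by (auto simp: D_def intro: rtrancl_into_rtrancl)
  qed
  have DRoot: "D Root" using root by (simp add: D_def)
  have path: "D (path_node a (\<phi> a) i)" if "a \<in> S" "i \<le> \<phi> a" for a i
    using that(2)
  proof (induction i)
    case 0
    show ?case using DRoot by (simp add: path_node_def)
  next
    case (Suc i)
    show ?case
    proof (rule D_step)
      show "D (path_node a (\<phi> a) i)" using Suc by simp
      show "path_node a (\<phi> a) i \<in> X" "path_node a (\<phi> a) (Suc i) \<in> X"
        using that(1) Suc.prems unfolding X_def by (meson UnI2 UN_I atMost_iff imageI insertI2 Suc_leD)+
    qed (use tree_edge that(1) Suc.prems in simp)
  qed
  \<comment> \<open>For \<phi> a = 0 the only path node is \<open>Root\<close>, so the path says
    nothing about \<open>Orig a\<close>; the premise equating the two variables steps in.\<close>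
  have DS: "D (Orig a)" if "a \<in> S" for a
  proof (cases "\<phi> a = 0")
    case True
    then show ?thesis using zero that DRoot by (simp add: D_def)
  next
    case False
    then show ?thesis using path[OF that, of "\<phi> a"] by (simp add: path_node_def)
  qed
  have DG: "D (Orig v)" if "v \<in> pverts G" for v
  proof -
    obtain a where a: "a \<in> S" "(a, v) \<in> (parcs G)\<^sup>*"
      using reachable_from_source_transversal[OF G S \<open>v \<in> pverts G\<close>] .
    from a(2) show ?thesis
    proof (induction rule: rtrancl_induct)
      case base
      show ?case using DS a(1) .
    next
      case (step u w)
      then have "Orig u \<in> X" "Orig w \<in> X"
        by (auto simp: X_def dest: G.in_arcsD1 G.in_arcsD2)
      then show ?case using edge[OF step(2)] by (rule D_step[OF step(3)])
    qed
  qed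
  have DX: "D x" if "x \<in> X" for x
    using that DRoot DG path by (auto simp: X_def)
  have "r \<in> pverts F" using root by (auto simp: F_def W_def X_def)
  moreover have "(r, p) \<in> (parcs F)\<^sup>*" if "p \<in> pverts F" for p
    using that DX by (force simp: F_def W_def D_def)
  ultimately have "is_term_graph F" using finF by (auto simp: is_term_graph_iff_rooted)
  moreover have "induced_subgraph (with_proj F) (with_proj H)"
  proof -
    have "wf_digraph (with_proj F)"
      using finF by (simp add: wf_digraph_wp_iff pair_fin_digraph_def)
    then show ?thesis
      using WH H.wf_digraph_axioms
      by (auto simp: induced_subgraph_def subgraph_def compatible_def F_def)
  qed
  ultimately have "induced_term_subgraph F H" by (simp add: induced_term_subgraph_def)
  moreover have "strong_hom (\<lambda>a. the (h (Orig a))) G F"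
  proof -
    have val: "h (Orig a) = Some (the (h (Orig a)))" "the (h (Orig a)) \<in> W" if "a \<in> pverts G" for a
      using DG[OF that] that by (auto simp: D_def W_def X_def)
    \<comment> \<open>A premise for a non-edge also holds when one of the values is \<infinity>; it
      yields a non-edge of \<open>H\<close> because \<open>val\<close> rules this out.\<close>
    have "(a, b) \<in> parcs G \<longleftrightarrow> (the (h (Orig a)), the (h (Orig b))) \<in> parcs H"
      if "a \<in> pverts G" "b \<in> pverts G" for a b
      using val(1)[OF that(1)] val(1)[OF that(2)] edge nonedge that by (metis option.sel)
    with val(2) show ?thesis by (auto simp: strong_hom_def F_def)
  qed
  ultimately show ?thesis by blast
qed

text \<open>The chosen walks may repeat vertices or meet each other although the tree paths are
  disjoint: an assignment need not be injective. A walk of length 0 forces g a = r, which is what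
  the premises for \<open>S_zero\<close> demand.\<close>

lemma not_models_Xi_of_term_subgraph:
  fixes G :: "'a pair_pre_digraph" and H :: "'b pair_pre_digraph"
  assumes G: "pair_fin_digraph G" and S: "source_transversal G S"
    and F: "induced_term_subgraph F H" and g: "strong_hom g G F"
  shows "\<exists>i\<in>Xi G S. \<not> models H i"
proof -
  interpret G: pair_fin_digraph G by fact
  have SG: "S \<subseteq> pverts G" using S by (rule source_transversal_subset)
  have FH: "pverts F \<subseteq> pverts H" "parcs F = {(u, v) \<in> parcs H. u \<in> pverts F \<and> v \<in> pverts F}"
    and "is_term_graph F"
    using F by (auto simp: induced_term_subgraph_def induced_subgraph_def subgraph_def)
  then obtain r where finF: "pair_fin_digraph F" and r: "r \<in> pverts F"
    and reach: "\<And>v. v \<in> pverts F \<Longrightarrow> (r, v) \<in> (parcs F)\<^sup>*"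
    by (auto simp: is_term_graph_iff_rooted)
  interpret F: pair_fin_digraph F by fact
  have gV: "g a \<in> pverts F" if "a \<in> pverts G" for a using g that by (simp add: strong_hom_def)
  \<comment> \<open>The premises are evaluated in the algebra of \<open>H\<close>; as
    \<open>F\<close> is induced, its edges and those of \<open>H\<close> agree on the image of
    \<open>g\<close>.\<close>
  have gE: "(a, b) \<in> parcs G \<longleftrightarrow> (g a, g b) \<in> parcs H" if "a \<in> pverts G" "b \<in> pverts G" for a b
    using g that gV FH(2) by (auto simp: strong_hom_def)
  have "\<exists>n w. w 0 = r \<and> w n = g a \<and> (\<forall>i<n. (w i, w (Suc i)) \<in> parcs F)" if "a \<in> S" for a
  proof -
    have "(r, g a) \<in> (parcs F)\<^sup>*" using reach gV SG that by blast
    then obtain n where "(r, g a) \<in> parcs F ^^ n" by (auto simp: rtrancl_power)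
    then show ?thesis by (auto simp: relpow_fun_conv)
  qed
  then obtain \<psi> w where w: "\<And>a. a \<in> S \<Longrightarrow> w a 0 = r" "\<And>a. a \<in> S \<Longrightarrow> w a (\<psi> a) = g a"
    "\<And>a i. a \<in> S \<Longrightarrow> i < \<psi> a \<Longrightarrow> (w a i, w a (Suc i)) \<in> parcs F"
    by metis
  \<comment> \<open>The functions indexing \<open>Xi\<close> are extensional on
    \<open>S\<close>.\<close>
  define \<phi> where "\<phi> = restrict \<psi> S"
  have \<phi>: "\<phi> a = \<psi> a" if "a \<in> S" for a using that by (simp add: \<phi>_def)
  have w_in: "w a i \<in> pverts F" if "a \<in> S" "i \<le> \<psi> a" for a i
    using that w(1) w(3)[THEN F.in_arcsD2] r by (cases i) auto
  \<comment> \<open>Names that do not occur in the implication need a value too. The bound on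
    \<open>i\<close> keeps the values of inner nodes within the walk and hence in \<open>F\<close>;
    \<open>None\<close> serves for the rest.\<close>
  define h where "h x = (case x of Orig a \<Rightarrow> if a \<in> pverts G then Some (g a) else None
    | Root \<Rightarrow> Some r
    | Inner a i \<Rightarrow> if a \<in> S \<and> i \<le> \<psi> a then Some (w a i) else None)" for x
  \<comment> \<open>The ends of the walk match the cases of \<open>path_node\<close>:
    \<open>Root\<close> has the value \<open>r\<close> and \<open>Orig a\<close> the value
    \<open>g a\<close>.\<close>
  have h_path: "h (path_node a (\<phi> a) i) = Some (w a i)" if "a \<in> S" "i \<le> \<psi> a" for a i
    using that w(1,2) SG by (auto simp: h_def path_node_def \<phi>)
  have "h x \<in> ga_universe H" for x
    using gV w_in r FH(1)[THEN subsetD] by (auto simp: h_def ga_universe_def split: node.split)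
  moreover have "\<forall>e\<in>alpha G S \<phi>. sat_identity H h e"
    unfolding sat_alpha_iff
  proof (intro conjI ballI allI impI)
    fix a b p assume "(a, b) \<in> parcs G" "h (Orig a) = Some p"
    moreover from this have "a \<in> pverts G" "b \<in> pverts G"
      by (auto dest: G.in_arcsD1 G.in_arcsD2)
    ultimately show "\<exists>q. h (Orig b) = Some q \<and> (p, q) \<in> parcs H"
      using gE by (auto simp: h_def)
  next
    fix a b p q assume "a \<in> pverts G" "b \<in> pverts G" "(a, b) \<notin> parcs G"
      "h (Orig a) = Some p" "h (Orig b) = Some q"
    then show "(p, q) \<notin> parcs H" using gE by (auto simp: h_def)
  next
    fix a i p assume "a \<in> S" "i < \<phi> a" "h (path_node a (\<phi> a) i) = Some p"
    then show "\<exists>q. h (path_node a (\<phi> a) (Suc i)) = Some q \<and> (p, q) \<in> parcs H"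
      using h_path[of a i] h_path[of a "Suc i"] w(3)[of a i] FH(2) by (auto simp: \<phi>)
  next
    fix a assume "a \<in> S" "\<phi> a = 0"
    then show "h (Orig a) = h Root"
      using w(1,2)[of a] SG by (auto simp: h_def \<phi>)
  qed
  moreover have "\<not> sat_identity H h beta"
    by (simp add: beta_def sat_identity_def h_def)
  ultimately have "\<not> models H (alpha G S \<phi>, beta)"
    unfolding models_def by auto
  moreover have "(alpha G S \<phi>, beta) \<in> Xi G S"
    unfolding Xi_def by (auto simp: \<phi>_def)
  ultimately show ?thesis by blast
qed

theorem proposition5p6:
  fixes G :: "'a pair_pre_digraph" and S :: "'a set"
  assumes "pair_fin_digraph G"
    and "source_transversal G S"
  shows "{H :: 'b pair_pre_digraph. pair_wf_digraph H \<and>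
            \<not> (\<exists>F h. induced_term_subgraph F H \<and> strong_hom h G F)} = Mod (Xi G S)"
proof (intro set_eqI iffI)
  fix H :: "'b pair_pre_digraph"
  assume "H \<in> {H. pair_wf_digraph H \<and> \<not> (\<exists>F h. induced_term_subgraph F H \<and> strong_hom h G F)}"
  then have H: "pair_wf_digraph H"
    and none: "\<not> (\<exists>F h. induced_term_subgraph F H \<and> strong_hom h G F)" by auto
  have "models H (alpha G S \<phi>, beta)" for \<phi>
    unfolding models_def
  proof (intro allI impI, unfold fst_conv snd_conv)
    fix h assume h: "\<forall>x. h x \<in> ga_universe H" "\<forall>e\<in>alpha G S \<phi>. sat_identity H h e"
    have "h Root = None"
    proof (cases "h Root")
      case (Some r)
      then show ?thesis using term_subgraph_of_sat_alpha[OF assms H _ h(2) Some] h(1) none by blast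
    qed
    then show "sat_identity H h beta" by (simp add: sat_identity_def beta_def)
  qed
  with H show "H \<in> Mod (Xi G S)" by (auto simp: Mod_def Xi_def)
next
  fix H :: "'b pair_pre_digraph"
  assume "H \<in> Mod (Xi G S)"
  then show "H \<in> {H. pair_wf_digraph H \<and> \<not> (\<exists>F h. induced_term_subgraph F H \<and> strong_hom h G F)}"
    using not_models_Xi_of_term_subgraph[OF assms] unfolding Mod_def by blast
qed

end
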